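(* Let $\mathbb{K}$ be $\mathbb{R}$ or $\mathbb{C}$, and let $u=(u_1,u_2,u_3):(\mathbb{K}^2,\mathbf{0})\to(\mathbb{K}^3,\mathbf{0})$ be an analytic germ having an isolated critical point at the origin. If $$\dim_{\mathbb{K}}\mathbb{K}\{x,y,z\}/\langle S_1,\ldots,S_{15}\rangle<+\infty,$$ then $u$ has no triple points (in a sufficiently small neighbourhood of the origin).
   Context: For $x=(x_1,x_2)$, $y=(y_1,y_2)$ put $w_i(x,y)=u_i(x)-u_i(y)$, $1\le i\le3$. Fix (non-unique) analytic germs $c_{ik}$ at $\mathbf{0}\in\mathbb{K}^4$ with $w_i(x,y)=c_{i1}(x,y)(x_1-y_1)+c_{i2}(x,y)(x_2-y_2)$, and for $1\le i<j\le3$ put $W_{ij}=c_{i1}c_{j2}-c_{i2}c_{j1}$. $\mathbb{K}\{x,y,z\}$ is the ring of convergent power series in the variables $x_1,x_2,y_1,y_2,z_1,z_2$. The germs $S_1,\ldots,S_{15}$ in this ring are: $S_1,S_2,S_3$ equal to $w_1(x,y),w_2(x,y),w_3(x,y)$; $S_4,S_5,S_6$ equal to $w_1(y,z),w_2(y,z),w_3(y,z)$; $S_7,S_8,S_9$ equal to $W_{12}(x,y),W_{13}(x,y),W_{23}(x,y)$; $S_{10},S_{11},S_{12}$ equal to $W_{12}(y,z),W_{13}(y,z),W_{23}(y,z)$; $S_{13},S_{14},S_{15}$ equal to $W_{12}(x,z),W_{13}(x,z),W_{23}(x,z)$. "$u$ has an isolated critical point at the origin" means that $\operatorname{rank}Du(\mathbf{0})<2$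 and $\operatorname{rank}Du(x)=2$ for all $x\ne\mathbf{0}$ in some neighbourhood of $\mathbf{0}$. A triple point is given by pairwise distinct $p,q,r\in\mathbb{K}^2$ with $u(p)=u(q)=u(r)$. *)

theory Defs
  imports "HOL-Analysis.Analysis" "HOL-Algebra.Embedded_Algebras" "HOL-Algebra.QuotRing"
begin

text \<open>
  The field is a type variable \<open>'k\<close> of class \<open>{real_normed_field, banach}\<close>. This class contains
  \<^typ>\<open>real\<close> and \<^typ>\<open>complex\<close>, and by Gelfand--Mazur every type in it is isomorphic to one of
  them. (The definitions themselves do not need completeness.)
  Germs at the origin are represented by total functions; all conditions imposed on them depend
  only on the values near the origin.
\<close>

subsection \<open>The ring of convergent power series\<close>

definition monomial :: "('n::finite \<Rightarrow> nat) \<Rightarrow> 'k::real_normed_field ^ 'n \<Rightarrow> 'k" where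
  "monomial e v = (\<Prod>i\<in>UNIV. v $ i ^ e i)"

text \<open>Being analytic at the origin: equal, on a polydisc, to the sum of a multiple power series.\<close>

definition analytic0 :: "('k::real_normed_field ^ 'n::finite \<Rightarrow> 'k) \<Rightarrow> bool" where
  "analytic0 f \<longleftrightarrow>
     (\<exists>a r. r > 0 \<and>
        (\<forall>v. (\<forall>i. norm (v $ i) < r) \<longrightarrow>
           (\<lambda>e. norm (a e * monomial e v)) summable_on UNIV \<and>
           ((\<lambda>e. a e * monomial e v) has_sum f v) UNIV))"

definition germ :: "('k::real_normed_field ^ 'n::finite \<Rightarrow> 'k) \<Rightarrow> ('k ^ 'n \<Rightarrow> 'k) set" where
  "germ f = {g. \<forall>\<^sub>F v in nhds 0. g v = f v}"

text \<open>
  A convergent power series is identified with the germ of its sum (the coefficients are determined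
  by the germ), so that the ring of convergent power series in variables indexed by \<open>'n\<close> becomes
  the ring of germs at the origin of analytic functions.
\<close>

definition convergent_series ::
    "('k::real_normed_field ^ 'n::finite \<Rightarrow> 'k) set ring" where
  "convergent_series =
     \<lparr>carrier = germ ` {f. analytic0 f},
      mult = (\<lambda>A B. \<Union>f\<in>A. \<Union>g\<in>B. germ (\<lambda>v. f v * g v)),
      one = germ (\<lambda>_. 1),
      zero = germ (\<lambda>_. 0),
      add = (\<lambda>A B. \<Union>f\<in>A. \<Union>g\<in>B. germ (\<lambda>v. f v + g v))\<rparr>"

text \<open>
  The field of scalars inside the quotient by \<open>I\<close> is the image of the constant germs. (For the
  improper ideal the quotient is the zero ring, which has dimension 0.)
\<close>

definition finite_dim_quotient ::
    "('k::real_normed_field ^ 'n::finite \<Rightarrow> 'k) set set \<Rightarrow> bool" where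
  "finite_dim_quotient I \<longleftrightarrow>
     ring.finite_dimension (convergent_series Quot I)
       (range (\<lambda>a. I +>\<^bsub>convergent_series\<^esub> germ (\<lambda>_. a)))
       (carrier (convergent_series Quot I))"

subsection \<open>Germs of maps from the plane to 3-space\<close>

text \<open>
  For \<open>'k = complex\<close>, \<^const>\<open>jacobian\<close> is built from the real Frechet derivative; for analytic
  maps this is complex linear, so its matrix is the complex Jacobian matrix.
\<close>

definition isolated_critical_point :: "('k::real_normed_field ^ 2 \<Rightarrow> 'k ^ 3) \<Rightarrow> bool" where
  "isolated_critical_point u \<longleftrightarrow>
     rank (jacobian u (at 0)) < 2 \<and> (\<forall>\<^sub>F x in at 0. rank (jacobian u (at x)) = 2)"

definition triple_point :: "('k::real_normed_field ^ 2 \<Rightarrow> 'k ^ 3) \<Rightarrow> 'k ^ 2 \<Rightarrow> 'k ^ 2 \<Rightarrow> 'k ^ 2 \<Rightarrow> bool" where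
  "triple_point u p q r \<longleftrightarrow> p \<noteq> q \<and> p \<noteq> r \<and> q \<noteq> r \<and> u p = u q \<and> u q = u r"

subsection \<open>The fifteen generators\<close>

definition pair4 :: "'k::zero ^ 2 \<Rightarrow> 'k ^ 2 \<Rightarrow> 'k ^ 4" where
  "pair4 x y = vector [x $ 1, x $ 2, y $ 1, y $ 2]"

definition diff_w :: "('k::real_normed_field ^ 2 \<Rightarrow> 'k ^ 3) \<Rightarrow> 3 \<Rightarrow> 'k ^ 2 \<Rightarrow> 'k ^ 2 \<Rightarrow> 'k" where
  "diff_w u i x y = u x $ i - u y $ i"

definition minor_W ::
    "(3 \<Rightarrow> 2 \<Rightarrow> 'k::real_normed_field ^ 4 \<Rightarrow> 'k) \<Rightarrow> 3 \<Rightarrow> 3 \<Rightarrow> 'k ^ 2 \<Rightarrow> 'k ^ 2 \<Rightarrow> 'k" where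
  "minor_W c i j x y =
     c i 1 (pair4 x y) * c j 2 (pair4 x y) - c i 2 (pair4 x y) * c j 1 (pair4 x y)"

text \<open>The coordinates of \<open>v :: 'k ^ 6\<close> are $x_1, x_2, y_1, y_2, z_1, z_2$ in this order.\<close>

definition x_of :: "'k::zero ^ 6 \<Rightarrow> 'k ^ 2" where "x_of v = vector [v $ 1, v $ 2]"
definition y_of :: "'k::zero ^ 6 \<Rightarrow> 'k ^ 2" where "y_of v = vector [v $ 3, v $ 4]"
definition z_of :: "'k::zero ^ 6 \<Rightarrow> 'k ^ 2" where "z_of v = vector [v $ 5, v $ 6]"

definition S_functions ::
    "('k::real_normed_field ^ 2 \<Rightarrow> 'k ^ 3) \<Rightarrow> (3 \<Rightarrow> 2 \<Rightarrow> 'k ^ 4 \<Rightarrow> 'k) \<Rightarrow> ('k ^ 6 \<Rightarrow> 'k) list" where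
  "S_functions u c =
    [\<lambda>v. diff_w u 1 (x_of v) (y_of v),
     \<lambda>v. diff_w u 2 (x_of v) (y_of v),
     \<lambda>v. diff_w u 3 (x_of v) (y_of v),
     \<lambda>v. diff_w u 1 (y_of v) (z_of v),
     \<lambda>v. diff_w u 2 (y_of v) (z_of v),
     \<lambda>v. diff_w u 3 (y_of v) (z_of v),
     \<lambda>v. minor_W c 1 2 (x_of v) (y_of v),
     \<lambda>v. minor_W c 1 3 (x_of v) (y_of v),
     \<lambda>v. minor_W c 2 3 (x_of v) (y_of v),
     \<lambda>v. minor_W c 1 2 (y_of v) (z_of v),
     \<lambda>v. minor_W c 1 3 (y_of v) (z_of v),
     \<lambda>v. minor_W c 2 3 (y_of v) (z_of v),
     \<lambda>v. minor_W c 1 2 (x_of v) (z_of v),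
     \<lambda>v. minor_W c 1 3 (x_of v) (z_of v),
     \<lambda>v. minor_W c 2 3 (x_of v) (z_of v)]"

definition S_ideal ::
    "('k::real_normed_field ^ 2 \<Rightarrow> 'k ^ 3) \<Rightarrow> (3 \<Rightarrow> 2 \<Rightarrow> 'k ^ 4 \<Rightarrow> 'k) \<Rightarrow> ('k ^ 6 \<Rightarrow> 'k) set set" where
  "S_ideal u c = Idl\<^bsub>convergent_series\<^esub> (germ ` set (S_functions u c))"

subsection \<open>Well-formedness: the germs form a commutative ring, which contains the generators\<close>

lemma monomial_zero [simp]: "monomial (\<lambda>_. 0) v = 1"
  by (simp add: monomial_def)

lemma monomial_add:
  fixes e d :: "'n::finite \<Rightarrow> nat"
  shows "monomial (\<lambda>i. e i + d i) v = monomial e v * monomial d v"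
  by (simp add: monomial_def power_add prod.distrib)

lemma analytic0E:
  assumes "analytic0 f"
  obtains a r where "r > 0"
    "\<And>v. \<forall>i. norm (v $ i) < r \<Longrightarrow> (\<lambda>e. norm (a e * monomial e v)) summable_on UNIV \<and>
       ((\<lambda>e. a e * monomial e v) has_sum f v) UNIV"
  using assms unfolding analytic0_def by blast

lemma analytic0_const: "analytic0 (\<lambda>_ :: 'k::real_normed_field ^ 'n::finite. c)"
proof -
  define a :: "('n \<Rightarrow> nat) \<Rightarrow> 'k" where "a = (\<lambda>e. if e = (\<lambda>_. 0) then c else 0)"
  have 1: "((\<lambda>e. a e * monomial e v) has_sum c) UNIV" for v :: "'k ^ 'n"
    by (rule has_sum_cong_neutral[THEN iffD1, of _ "{\<lambda>_. 0}" _ "\<lambda>e. a e * monomial e v"])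
      (auto simp: a_def intro!: has_sum_finiteI)
  have 2: "((\<lambda>e. norm (a e * monomial e v)) has_sum (norm c)) UNIV" for v :: "'k ^ 'n"
    by (rule has_sum_cong_neutral[THEN iffD1, of _ "{\<lambda>_. 0}" _ "\<lambda>e. norm (a e * monomial e v)"])
      (auto simp: a_def intro!: has_sum_finiteI)
  show ?thesis
    unfolding analytic0_def
    by (rule exI[of _ a], rule exI[of _ 1]) (use 1 2 in \<open>auto simp: summable_on_def\<close>)
qed

lemma analytic0_add:
  assumes "analytic0 f" "analytic0 g"
  shows "analytic0 (\<lambda>v. f v + g v)"
proof -
  obtain a r where a: "r > 0" "\<And>v. (\<forall>i. norm (v $ i) < r) \<Longrightarrow>
      (\<lambda>e. norm (a e * monomial e v)) summable_on UNIV \<and> ((\<lambda>e. a e * monomial e v) has_sum f v) UNIV"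
    by (rule analytic0E[OF assms(1)]) blast
  obtain b s where b: "s > 0" "\<And>v. (\<forall>i. norm (v $ i) < s) \<Longrightarrow>
      (\<lambda>e. norm (b e * monomial e v)) summable_on UNIV \<and> ((\<lambda>e. b e * monomial e v) has_sum g v) UNIV"
    by (rule analytic0E[OF assms(2)]) blast
  have "(\<lambda>e. norm ((a e + b e) * monomial e v)) summable_on UNIV \<and>
        ((\<lambda>e. (a e + b e) * monomial e v) has_sum (f v + g v)) UNIV"
    if "\<forall>i. norm (v $ i) < min r s" for v
  proof
    have 1: "(\<lambda>e. norm (a e * monomial e v)) summable_on UNIV" "((\<lambda>e. a e * monomial e v) has_sum f v) UNIV"
      "(\<lambda>e. norm (b e * monomial e v)) summable_on UNIV" "((\<lambda>e. b e * monomial e v) has_sum g v) UNIV"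
      using a(2)[of v] b(2)[of v] that by auto
    show "((\<lambda>e. (a e + b e) * monomial e v) has_sum (f v + g v)) UNIV"
      using has_sum_add[OF 1(2,4)] by (simp add: algebra_simps)
    have "(\<lambda>e. norm (a e * monomial e v) + norm (b e * monomial e v)) summable_on UNIV"
      using 1 by (intro summable_on_add)
    then show "(\<lambda>e. norm ((a e + b e) * monomial e v)) summable_on UNIV"
      by (rule Infinite_Sum.abs_summable_on_comparison_test') (simp add: distrib_right norm_triangle_ineq)
  qed
  then show ?thesis unfolding analytic0_def using a(1) b(1)
    by (intro exI[of _ "\<lambda>e. a e + b e"] exI[of _ "min r s"]) auto
qed

lemma finite_splits: "finite {p :: ('n::finite \<Rightarrow> nat) \<times> ('n \<Rightarrow> nat). (\<lambda>i. fst p i + snd p i) = e}"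
proof (rule finite_subset)
  show "{p. (\<lambda>i. fst p i + snd p i) = e} \<subseteq> (PiE UNIV (\<lambda>i. {..e i})) \<times> (PiE UNIV (\<lambda>i. {..e i}))"
    by (auto simp: PiE_def Pi_def)
qed (auto intro!: finite_cartesian_product finite_PiE)

lemma analytic0_mult:
  fixes f g :: "'k::{real_normed_field, banach} ^ 'n::finite \<Rightarrow> 'k"
  assumes "analytic0 f" "analytic0 g"
  shows "analytic0 (\<lambda>v. f v * g v)"
proof -
  obtain a r where a: "r > 0" "\<And>v. (\<forall>i. norm (v $ i) < r) \<Longrightarrow>
      (\<lambda>e. norm (a e * monomial e v)) summable_on UNIV \<and> ((\<lambda>e. a e * monomial e v) has_sum f v) UNIV"
    by (rule analytic0E[OF assms(1)]) blast
  obtain b s where b: "s > 0" "\<And>v. (\<forall>i. norm (v $ i) < s) \<Longrightarrow>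
      (\<lambda>e. norm (b e * monomial e v)) summable_on UNIV \<and> ((\<lambda>e. b e * monomial e v) has_sum g v) UNIV"
    by (rule analytic0E[OF assms(2)]) blast
  define B :: "('n \<Rightarrow> nat) \<Rightarrow> (('n \<Rightarrow> nat) \<times> ('n \<Rightarrow> nat)) set"
    where "B = (\<lambda>e. {p. (\<lambda>i. fst p i + snd p i) = e})"
  have finB: "finite (B e)" for e unfolding B_def by (rule finite_splits)
  define m where "m = (\<lambda>e. \<Sum>p\<in>B e. a (fst p) * b (snd p))"
  have "(\<lambda>e. norm (m e * monomial e v)) summable_on UNIV \<and>
        ((\<lambda>e. m e * monomial e v) has_sum (f v * g v)) UNIV"
    if v: "\<forall>i. norm (v $ i) < min r s" for v
  proof -
    define x where "x = (\<lambda>e. a e * monomial e v)"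
    define y where "y = (\<lambda>e. b e * monomial e v)"
    have 1: "(\<lambda>e. norm (x e)) summable_on UNIV" "(x has_sum f v) UNIV" "(\<lambda>e. norm (y e)) summable_on UNIV" "(y has_sum g v) UNIV"
      using a(2)[of v] b(2)[of v] v by (auto simp: x_def y_def)
    have "(\<lambda>p. norm (x (fst p) * y (snd p))) summable_on (UNIV \<times> UNIV)"
    proof (rule Infinite_Sum.abs_summable_on_Sigma_iff[THEN iffD2], intro conjI ballI)
      fix d
      show "(\<lambda>e. norm (x (fst (d, e)) * y (snd (d, e)))) summable_on UNIV"
        using summable_on_cmult_right[OF 1(3), of "norm (x d)"] by (simp add: norm_mult)
    next
      show "(\<lambda>d. norm (\<Sum>\<^sub>\<infinity>e. norm (x (fst (d, e)) * y (snd (d, e))))) summable_on UNIV"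
        using summable_on_cmult_left[OF 1(1), of "\<Sum>\<^sub>\<infinity>e. norm (y e)"]
        by (simp add: norm_mult infsum_cmult_right' abs_mult infsum_nonneg)
    qed
    then have abs: "(\<lambda>p. norm (x (fst p) * y (snd p))) summable_on UNIV" by simp
    have hs: "((\<lambda>p. x (fst p) * y (snd p)) has_sum (f v * g v)) (UNIV \<times> UNIV)"
    proof (rule has_sum_SigmaI)
      show "((\<lambda>e. x (fst (d, e)) * y (snd (d, e))) has_sum (x d * g v)) UNIV" for d
        using has_sum_cmult_right[OF 1(4), of "x d"] by simp
      show "((\<lambda>d. x d * g v) has_sum (f v * g v)) UNIV"
        using has_sum_cmult_left[OF 1(2)] .
      show "(\<lambda>p. x (fst p) * y (snd p)) summable_on UNIV \<times> UNIV"
        using abs by (simp add: abs_summable_summable)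
    qed
    have bij: "bij_betw snd (SIGMA e:UNIV. B e) UNIV"
      unfolding bij_betw_def inj_on_def B_def by (force simp: image_def)
    have m: "m e * monomial e v = (\<Sum>p\<in>B e. x (fst p) * y (snd p))" for e
    proof -
      have "x (fst p) * y (snd p) = a (fst p) * b (snd p) * monomial e v" if "p \<in> B e" for p
      proof -
        have "e = (\<lambda>i. fst p i + snd p i)" using that by (simp add: B_def)
        then have "monomial e v = monomial (fst p) v * monomial (snd p) v" by (simp add: monomial_add)
        then show ?thesis by (simp add: x_def y_def)
      qed
      then show ?thesis by (simp add: m_def sum_distrib_right)
    qed
    have hs': "((\<lambda>q. x (fst (snd q)) * y (snd (snd q))) has_sum (f v * g v)) (SIGMA e:UNIV. B e)"
      using has_sum_reindex_bij_betw[OF bij, of "\<lambda>p. x (fst p) * y (snd p)"] hs by simp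
    have abs': "(\<lambda>q. norm (x (fst (snd q)) * y (snd (snd q)))) summable_on (SIGMA e:UNIV. B e)"
      using summable_on_reindex_bij_betw[OF bij, of "\<lambda>p. norm (x (fst p) * y (snd p))"] abs by simp
    have "((\<lambda>e. m e * monomial e v) has_sum (f v * g v)) UNIV"
      by (rule has_sum_SigmaD[OF hs']) (simp add: m has_sum_finiteI finB)
    moreover obtain L where L: "((\<lambda>q. norm (x (fst (snd q)) * y (snd (snd q)))) has_sum L) (SIGMA e:UNIV. B e)"
      using abs' by (auto simp: summable_on_def)
    have "((\<lambda>e. \<Sum>p\<in>B e. norm (x (fst p) * y (snd p))) has_sum L) UNIV"
      by (rule has_sum_SigmaD[OF L]) (simp add: has_sum_finiteI finB)
    then have "(\<lambda>e. \<Sum>p\<in>B e. norm (x (fst p) * y (snd p))) summable_on UNIV"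
      by (auto simp: summable_on_def)
    then have "(\<lambda>e. norm (m e * monomial e v)) summable_on UNIV"
      by (rule Infinite_Sum.abs_summable_on_comparison_test') (simp add: m norm_sum)
    ultimately show ?thesis by blast
  qed
  then show ?thesis unfolding analytic0_def using a(1) b(1)
    by (intro exI[of _ m] exI[of _ "min r s"]) auto
qed

lemma analytic0_uminus:
  fixes f :: "'k::{real_normed_field, banach} ^ 'n::finite \<Rightarrow> 'k"
  shows "analytic0 f \<Longrightarrow> analytic0 (\<lambda>v. - f v)"
  using analytic0_mult[OF analytic0_const[of "-1"]] by force

lemma analytic0_diff:
  fixes f :: "'k::{real_normed_field, banach} ^ 'n::finite \<Rightarrow> 'k"
  shows "analytic0 f \<Longrightarrow> analytic0 g \<Longrightarrow> analytic0 (\<lambda>v. f v - g v)"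
  using analytic0_add[OF _ analytic0_uminus] by force

lemma analytic0_select:
  fixes \<sigma> :: "'m::finite \<Rightarrow> 'n::finite"
  assumes "inj \<sigma>" "analytic0 f"
  shows "analytic0 (\<lambda>v. f (\<chi> i. v $ \<sigma> i))"
proof -
  obtain a r where a: "r > 0" "\<And>v. (\<forall>i. norm (v $ i) < r) \<Longrightarrow>
      (\<lambda>e. norm (a e * monomial e v)) summable_on UNIV \<and> ((\<lambda>e. a e * monomial e v) has_sum f v) UNIV"
    by (rule analytic0E[OF assms(2)]) blast
  define h :: "('m \<Rightarrow> nat) \<Rightarrow> 'n \<Rightarrow> nat" where
    "h = (\<lambda>e j. if j \<in> range \<sigma> then e (inv_into UNIV \<sigma> j) else 0)"
  have hs: "h e (\<sigma> i) = e i" for e i using assms(1) by (simp add: h_def)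
  have inj: "inj h" by (rule injI) (metis hs ext)
  define b where "b = (\<lambda>d. if d \<in> range h then a (inv_into UNIV h d) else 0)"
  have mon: "monomial (h e) v = monomial e (\<chi> i. v $ \<sigma> i)" for e and v :: "'a ^ 'n"
  proof -
    have "monomial (h e) v = (\<Prod>j\<in>range \<sigma>. v $ j ^ h e j)"
      unfolding monomial_def by (rule prod.mono_neutral_right) (auto simp: h_def)
    also have "\<dots> = monomial e (\<chi> i. v $ \<sigma> i)"
      by (simp add: prod.reindex[OF assms(1)] hs monomial_def)
    finally show ?thesis .
  qed
  have bh: "b (h e) = a e" for e using inj by (simp add: b_def)
  have "(\<lambda>d. norm (b d * monomial d v)) summable_on UNIV \<and>
        ((\<lambda>d. b d * monomial d v) has_sum f (\<chi> i. v $ \<sigma> i)) UNIV"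
    if v: "\<forall>i. norm (v $ i) < r" for v
  proof
    let ?w = "\<chi> i. v $ \<sigma> i"
    have 1: "(\<lambda>e. norm (a e * monomial e ?w)) summable_on UNIV" "((\<lambda>e. a e * monomial e ?w) has_sum f ?w) UNIV"
      using a(2)[of ?w] v by auto
    have "((\<lambda>d. b d * monomial d v) has_sum f ?w) (range h)"
      using has_sum_reindex[OF inj, of "\<lambda>d. b d * monomial d v"] 1(2) by (simp add: o_def bh mon)
    then show "((\<lambda>d. b d * monomial d v) has_sum f ?w) UNIV"
      by (rule has_sum_cong_neutral[THEN iffD1, rotated -1]) (auto simp: b_def)
    obtain L where L: "((\<lambda>e. norm (a e * monomial e ?w)) has_sum L) UNIV"
      using 1 by (auto simp: summable_on_def)
    have "((\<lambda>d. norm (b d * monomial d v)) has_sum L) (range h)"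
      using has_sum_reindex[OF inj, of "\<lambda>d. norm (b d * monomial d v)"] L by (simp add: o_def bh mon)
    then have "((\<lambda>d. norm (b d * monomial d v)) has_sum L) UNIV"
      by (rule has_sum_cong_neutral[THEN iffD1, rotated -1]) (auto simp: b_def)
    then show "(\<lambda>d. norm (b d * monomial d v)) summable_on UNIV" by (auto simp: summable_on_def)
  qed
  then show ?thesis unfolding analytic0_def using a(1) by (intro exI[of _ b] exI[of _ r]) auto
qed

lemma germ_eq:
  fixes f0 g0 :: "'k::real_normed_field ^ 'n::finite \<Rightarrow> 'k" and F :: "'k \<Rightarrow> 'k \<Rightarrow> 'k"
  shows "(\<Union>f\<in>germ f0. \<Union>g\<in>germ g0. germ (\<lambda>v. F (f v) (g v))) = germ (\<lambda>v. F (f0 v) (g0 v))"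
proof (rule Set.set_eqI, rule iffI)
  fix h assume "h \<in> (\<Union>f\<in>germ f0. \<Union>g\<in>germ g0. germ (\<lambda>v. F (f v) (g v)))"
  then obtain f g where "\<forall>\<^sub>F v in nhds 0. f v = f0 v" "\<forall>\<^sub>F v in nhds 0. g v = g0 v"
    "\<forall>\<^sub>F v in nhds 0. h v = F (f v) (g v)" by (auto simp: germ_def)
  then have "\<forall>\<^sub>F v in nhds 0. h v = F (f0 v) (g0 v)" by eventually_elim simp
  then show "h \<in> germ (\<lambda>v. F (f0 v) (g0 v))" by (simp add: germ_def)
next
  fix h assume "h \<in> germ (\<lambda>v. F (f0 v) (g0 v))"
  moreover have "f0 \<in> germ f0" "g0 \<in> germ g0" by (auto simp: germ_def)
  ultimately show "h \<in> (\<Union>f\<in>germ f0. \<Union>g\<in>germ g0. germ (\<lambda>v. F (f v) (g v)))" by blast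
qed

lemma germ_mult: "germ f \<otimes>\<^bsub>convergent_series\<^esub> germ g = germ (\<lambda>v. f v * g v)"
  by (simp add: convergent_series_def germ_eq)

lemma germ_add: "germ f \<oplus>\<^bsub>convergent_series\<^esub> germ g = germ (\<lambda>v. f v + g v)"
  by (simp add: convergent_series_def germ_eq)

lemma carrier_convergent_series: "carrier convergent_series = germ ` {f. analytic0 f}"
  and one_convergent_series: "\<one>\<^bsub>convergent_series\<^esub> = germ (\<lambda>_. 1)"
  and zero_convergent_series: "\<zero>\<^bsub>convergent_series\<^esub> = germ (\<lambda>_. 0)"
  by (simp_all add: convergent_series_def)

lemma cring_convergent_series:
  "cring (convergent_series :: ('k::{real_normed_field, banach} ^ 'n::finite \<Rightarrow> 'k) set ring)"
proof (intro cringI abelian_groupI comm_monoidI, goal_cases)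
  case (6 x)
  then obtain f where f: "analytic0 f" "x = germ f" by (auto simp: carrier_convergent_series)
  then show ?case
    by (intro bexI[of _ "germ (\<lambda>v. - f v)"])
      (auto simp: germ_add carrier_convergent_series zero_convergent_series analytic0_uminus)
qed (auto simp: carrier_convergent_series one_convergent_series zero_convergent_series germ_mult germ_add
      analytic0_add analytic0_mult analytic0_const algebra_simps)

lemma vector_4':
  "(vector [a,b,c,d] :: 'a::zero^4) $ 1 = a" "(vector [a,b,c,d] :: 'a::zero^4) $ 2 = b"
  "(vector [a,b,c,d] :: 'a::zero^4) $ 3 = c" "(vector [a,b,c,d] :: 'a::zero^4) $ 4 = d"
  unfolding vector_def by auto

definition sel4 :: "6 \<Rightarrow> 6 \<Rightarrow> 6 \<Rightarrow> 6 \<Rightarrow> 4 \<Rightarrow> 6" where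
  "sel4 p q r s i = (if i = 1 then p else if i = 2 then q else if i = 3 then r else s)"

lemma inj_sel4: "distinct [p,q,r,s] \<Longrightarrow> inj (sel4 p q r s)"
  unfolding inj_def forall_4 by (auto simp: sel4_def)

lemma S_functions_analytic0:
  fixes u :: "'k::{real_normed_field, banach} ^ 2 \<Rightarrow> 'k ^ 3"
  assumes u: "\<And>i. analytic0 (\<lambda>x. u x $ i)" and c: "\<And>i k. analytic0 (c i k)"
  shows "f \<in> set (S_functions u c) \<Longrightarrow> analytic0 f"
proof -
  have vec2: "(vector [v $ p, v $ q] :: 'k^2) = (\<chi> i. v $ (if i = 1 then p else q))" for v :: "'k^6" and p q
    by (simp add: vec_eq_iff forall_2 vector_2)
  have vec4: "(vector [v $ p, v $ q, v $ r, v $ s] :: 'k^4) = (\<chi> i. v $ sel4 p q r s i)" for v :: "'k^6" and p q r s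
    by (simp add: vec_eq_iff forall_4 sel4_def vector_4')
  have 2: "analytic0 (\<lambda>v::'k^6. u (vector [v $ p, v $ q]) $ i)" if "p \<noteq> q" for p q i
    unfolding vec2 by (rule analytic0_select[OF _ u]) (use that in \<open>auto simp: inj_def forall_2\<close>)
  have 4: "analytic0 (\<lambda>v::'k^6. c i k (vector [v $ p, v $ q, v $ r, v $ s]))" if "distinct [p,q,r,s]" for p q r s i k
    unfolding vec4 by (rule analytic0_select[OF inj_sel4[OF that] c])
  show "f \<in> set (S_functions u c) \<Longrightarrow> analytic0 f"
    unfolding S_functions_def x_of_def y_of_def z_of_def
    by (auto simp: diff_w_def minor_W_def pair4_def intro!: 2 4 analytic0_diff analytic0_mult)
qed

end

theory Submission
  imports Defs "HOL-Computational_Algebra.Polynomial"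
begin

text \<open>
  In a finite-dimensional quotient the powers of each coordinate are linearly dependent, so the ideal
  contains a nonzero polynomial in each single coordinate. Such a polynomial has only finitely many
  roots, hence the common zeros of the generators near the origin reduce to the origin itself.
  On the other hand, every triple point \<open>(p, q, r)\<close> is a common zero of the \<open>S\<^sub>i\<close>: the
  differences vanish, and since \<open>u(p) = u(q)\<close> the matrix \<open>(c\<^sub>i\<^sub>k(p, q))\<close> kills \<open>p - q \<noteq> 0\<close>, so that its
  minors vanish, and similarly for the other two pairs.
\<close>

section \<open>Germs of constants, coordinates and polynomials\<close>

lemma germ_eq_iff: "germ f = germ g \<longleftrightarrow> (\<forall>\<^sub>F v in nhds 0. f v = g v)"
proof
  assume "germ f = germ g"
  moreover have "f \<in> germ f" by (simp add: germ_def)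
  ultimately show "\<forall>\<^sub>F v in nhds 0. f v = g v" by (simp add: germ_def)
next
  assume ev: "\<forall>\<^sub>F v in nhds 0. f v = g v"
  have "(\<forall>\<^sub>F v in nhds 0. h v = f v) \<longleftrightarrow> (\<forall>\<^sub>F v in nhds 0. h v = g v)" for h
    by (rule eventually_cong[OF ev]) auto
  then show "germ f = germ g" by (auto simp: germ_def)
qed

text \<open>Functions that agree near the origin agree at the origin itself, so the scalars embed
  into the ring of germs.\<close>

lemma germ_const_eq_iff:
  fixes a b :: "'k::real_normed_field"
  shows "germ (\<lambda>_ :: 'k ^ 'n::finite. a) = germ (\<lambda>_. b) \<longleftrightarrow> a = b"
  by (auto simp: germ_eq_iff dest: eventually_nhds_x_imp_x)

lemma analytic0_coordinate: "analytic0 (\<lambda>v :: 'k::real_normed_field ^ 'n::finite. v $ i)"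
proof -
  define d :: "'n \<Rightarrow> nat" where "d = (\<lambda>j. if j = i then 1 else 0)"
  have d: "monomial d v = v $ i" for v :: "'k ^ 'n"
    by (simp add: monomial_def d_def if_distrib[of "\<lambda>k. _ ^ k"] prod.delta cong: if_cong)
  define a :: "('n \<Rightarrow> nat) \<Rightarrow> 'k" where "a = (\<lambda>e. if e = d then 1 else 0)"
  have 1: "((\<lambda>e. a e * monomial e v) has_sum (v $ i)) UNIV" for v :: "'k ^ 'n"
    by (rule has_sum_cong_neutral[THEN iffD1, of _ "{d}" _ "\<lambda>e. a e * monomial e v"])
      (auto simp: a_def d intro!: has_sum_finiteI)
  have 2: "((\<lambda>e. norm (a e * monomial e v)) has_sum (norm (v $ i))) UNIV" for v :: "'k ^ 'n"
    by (rule has_sum_cong_neutral[THEN iffD1, of _ "{d}" _ "\<lambda>e. norm (a e * monomial e v)"])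
      (auto simp: a_def d intro!: has_sum_finiteI)
  show ?thesis
    unfolding analytic0_def
    by (rule exI[of _ a], rule exI[of _ 1]) (use 1 2 in \<open>auto simp: summable_on_def\<close>)
qed

lemma analytic0_power:
  fixes f :: "'k::{real_normed_field, banach} ^ 'n::finite \<Rightarrow> 'k"
  assumes "analytic0 f"
  shows "analytic0 (\<lambda>v. f v ^ m)"
  by (induction m) (auto intro: analytic0_const analytic0_mult assms)

lemma analytic0_poly:
  fixes f :: "'k::{real_normed_field, banach} ^ 'n::finite \<Rightarrow> 'k"
  assumes "analytic0 f"
  shows "analytic0 (\<lambda>v. poly p (f v))"
proof (induction p)
  case (pCons a p)
  then show ?case
    using analytic0_add[OF analytic0_const[of a] analytic0_mult[OF assms pCons.IH]] by simp
qed (simp add: analytic0_const)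

section \<open>Finite dimension and polynomials in the ideal\<close>

text \<open>The linear algebra of \<open>dimension\<close> and \<open>independent\<close> is
  developed over subfields; the coset map carries this one to the scalars of the quotient.\<close>

lemma subfield_constant_germs:
  "subfield (range (\<lambda>a. germ (\<lambda>_. a)))
     (convergent_series :: ('k::{real_normed_field, banach} ^ 'n::finite \<Rightarrow> 'k) set ring)"
  (is "subfield ?K ?R")
proof -
  interpret cring ?R by (rule cring_convergent_series)
  have neg: "\<ominus>\<^bsub>?R\<^esub> germ (\<lambda>_. a) = germ (\<lambda>_. - a)" for a :: 'k
    by (rule minus_equality)
      (auto simp: germ_add carrier_convergent_series zero_convergent_series analytic0_const)
  have "subring ?K ?R"
    by (rule subringI)
      (auto simp: carrier_convergent_series one_convergent_series neg germ_add germ_mult analytic0_const)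
  then have "subcring ?K ?R" by (rule subcringI')
  moreover have "Units (?R \<lparr>carrier := ?K\<rparr>) = ?K - {\<zero>\<^bsub>?R\<^esub>}"
  proof -
    \<comment> \<open>Constant germs multiply like their values, so invertibility is decided in
      \<open>'k\<close>, with the germ of \<open>inverse a\<close> as inverse.\<close>
    have const: "(\<exists>x\<in>?K. x \<otimes>\<^bsub>?R\<^esub> germ (\<lambda>_. a) = \<one>\<^bsub>?R\<^esub> \<and> germ (\<lambda>_. a) \<otimes>\<^bsub>?R\<^esub> x = \<one>\<^bsub>?R\<^esub>) \<longleftrightarrow> a \<noteq> 0" for a
      unfolding bex_simps(7) germ_mult one_convergent_series germ_const_eq_iff
      by (auto intro: exI[of _ "inverse a"])
    have "(\<exists>x\<in>?K. x \<otimes>\<^bsub>?R\<^esub> y = \<one>\<^bsub>?R\<^esub> \<and> y \<otimes>\<^bsub>?R\<^esub> x = \<one>\<^bsub>?R\<^esub>) \<longleftrightarrow> y \<noteq> \<zero>\<^bsub>?R\<^esub>" if y: "y \<in> ?K" for y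
    proof -
      obtain a where "y = germ (\<lambda>_. a)" using y by blast
      then show ?thesis by (simp only: const zero_convergent_series germ_const_eq_iff)
    qed
    then show ?thesis unfolding Units_def by auto
  qed
  ultimately show ?thesis by (rule subfieldI)
qed

text \<open>If the quotient has dimension \<open>n\<close>, the classes of \<open>g ^ 0\<close>,
  ..., \<open>g ^ n\<close> are dependent, and the coefficients of a non-trivial relation are those
  of \<open>p\<close>.\<close>

lemma finite_dim_quotient_polynomial:
  fixes I :: "('k::{real_normed_field, banach} ^ 'n::finite \<Rightarrow> 'k) set set"
  assumes I: "ideal I convergent_series"
    and fin: "finite_dim_quotient I"
    and g: "analytic0 g"
  shows "\<exists>p. p \<noteq> 0 \<and> germ (\<lambda>v. poly p (g v)) \<in> I"
proof -
  let ?R = "convergent_series :: ('k ^ 'n \<Rightarrow> 'k) set ring"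
  let ?Q = "?R Quot I"
  define h where "h = (\<lambda>f. I +>\<^bsub>?R\<^esub> germ f)"
  let ?K = "range (\<lambda>a. h (\<lambda>_. a))"
  interpret I: ideal I ?R by (rule I)
  interpret H: ring_hom_ring ?R ?Q "(+>\<^bsub>?R\<^esub>) I" by (rule I.rcos_ring_hom_ring)
  have carr: "germ f \<in> carrier ?R" if "analytic0 f" for f
    using that by (auto simp: carrier_convergent_series)
  have h_carr: "h f \<in> carrier ?Q" if "analytic0 f" for f
    unfolding h_def by (rule H.hom_closed[OF carr[OF that]])
  have h_add: "h f \<oplus>\<^bsub>?Q\<^esub> h f' = h (\<lambda>v. f v + f' v)" if "analytic0 f" "analytic0 f'" for f f'
    unfolding h_def using H.hom_add[OF carr carr, OF that] by (simp add: germ_add)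
  have h_mult: "h f \<otimes>\<^bsub>?Q\<^esub> h f' = h (\<lambda>v. f v * f' v)" if "analytic0 f" "analytic0 f'" for f f'
    unfolding h_def using H.hom_mult[OF carr carr, OF that] by (simp add: germ_mult)
  have h_zero: "\<zero>\<^bsub>?Q\<^esub> = h (\<lambda>_. 0)"
    unfolding h_def zero_convergent_series[symmetric] by simp
  have h_mem: "germ f \<in> I" if "analytic0 f" "h f = \<zero>\<^bsub>?Q\<^esub>" for f
  proof (rule I.a_coset_join1)
    show "I +>\<^bsub>?R\<^esub> germ f = I" using that(2) unfolding h_def FactRing_def by simp
    show "germ f \<in> carrier ?R" by (rule carr[OF that(1)])
  qed (rule I.a_subgroup)
  show ?thesis
  \<comment> \<open>In the zero ring the scalars do not form a field and the dimension argument
    breaks down; but then \<open>I\<close> contains the germ of 1, and the constant polynomial 1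
    serves.\<close>
  proof (cases "\<one>\<^bsub>?Q\<^esub> = \<zero>\<^bsub>?Q\<^esub>")
    case True
    moreover have "\<one>\<^bsub>?Q\<^esub> = h (\<lambda>_. 1)"
      unfolding h_def one_convergent_series[symmetric] by simp
    ultimately have "germ (\<lambda>_. 1) \<in> I" using h_mem analytic0_const by metis
    then show ?thesis by (intro exI[of _ 1]) simp
  next
    case False
    have K: "subfield ?K ?Q"
      using H.img_is_subfield(2)[OF subfield_constant_germs False] by (simp add: image_image h_def)
    obtain n where n: "H.S.dimension n ?K (carrier ?Q)"
      using fin by (auto simp: finite_dim_quotient_def H.S.finite_dimension_def h_def)
    \<comment> \<open>Classes of \<open>k\<close> consecutive powers of \<open>g\<close> from
      exponent \<open>m\<close> on; the free start \<open>m\<close> lets the induction for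
      \<open>combine\<close> pass to the tail of the list.\<close>
    define Us where "Us = (\<lambda>m k. map (\<lambda>j. h (\<lambda>v. g v ^ j)) [m..<m + k])"
    have Us: "set (Us m k) \<subseteq> carrier ?Q" for m k
      by (auto simp: Us_def intro: h_carr analytic0_power g)
    \<comment> \<open>These are \<open>Suc n\<close> vectors, one more than the dimension.\<close>
    have "\<not> H.S.independent ?K (Us 0 (Suc n))"
      using H.S.independent_length_le_dimension[OF K n _ Us, of 0 "Suc n"] by (auto simp: Us_def)
    then obtain Ks where Ks: "length Ks = length (Us 0 (Suc n))" "H.S.combine Ks (Us 0 (Suc n)) = \<zero>\<^bsub>?Q\<^esub>"
        "set Ks \<subseteq> ?K" "set Ks \<noteq> {\<zero>\<^bsub>?Q\<^esub>}"
      by (rule H.S.dependent_imp_non_trivial_combine[OF K Us])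
    \<comment> \<open>Representing scalars of the coefficients; \<open>Poly as\<close> reads them
      with the constant term first, matching the order of the powers in
      \<open>Us 0 (Suc n)\<close>.\<close>
    obtain as where as: "Ks = map (\<lambda>a. h (\<lambda>_. a)) as"
      using Ks(3) ex_map_conv[of Ks "\<lambda>a. h (\<lambda>_. a)"] by blast
    have len: "length as = Suc n" using Ks(1) by (simp add: as Us_def)
    have combine: "H.S.combine (map (\<lambda>a. h (\<lambda>_. a)) as) (Us m (length as))
        = h (\<lambda>v. g v ^ m * poly (Poly as) (g v))" for m as
    proof (induction as arbitrary: m)
      case Nil
      then show ?case by (simp add: Us_def h_zero)
    next
      case (Cons a as)
      have "Us m (length (a # as)) = h (\<lambda>v. g v ^ m) # Us (Suc m) (length as)"
        by (simp add: Us_def upt_conv_Cons del: upt_Suc)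
      then show ?case
        by (simp add: Cons.IH h_mult h_add g analytic0_const analytic0_power analytic0_poly
            analytic0_mult algebra_simps)
    qed
    have "h (\<lambda>v. poly (Poly as) (g v)) = \<zero>\<^bsub>?Q\<^esub>"
      using Ks(2) combine[of as 0] by (simp add: as len)
    then have "germ (\<lambda>v. poly (Poly as) (g v)) \<in> I"
      by (rule h_mem[OF analytic0_poly[OF g]])
    \<comment> \<open>If \<open>as\<close> were all zero, then \<open>set Ks\<close> would be
      exactly the singleton of zero, since the length \<open>Suc n\<close> rules out the empty list;
      the choice of \<open>Ks\<close> excludes this.\<close>
    moreover have "Poly as \<noteq> 0"
    proof
      assume "Poly as = 0"
      then obtain k where "as = replicate k 0" by (auto simp: Poly_eq_0)
      then have "set Ks = {\<zero>\<^bsub>?Q\<^esub>}" using len by (auto simp: as h_zero)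
      then show False using Ks(4) by blast
    qed
    ultimately show ?thesis by blast
  qed
qed

section \<open>Common zeros of the generators of an ideal\<close>

text \<open>The germs vanishing on the common zeros of \<open>F\<close> near the origin form an
  ideal \<open>J\<close> containing the generators, and the generated ideal is the smallest such.
  Minimality replaces an explicit combination of generators.\<close>

lemma genideal_vanishes:
  fixes F :: "('k::{real_normed_field, banach} ^ 'n::finite \<Rightarrow> 'k) set"
  assumes F: "\<And>f. f \<in> F \<Longrightarrow> analytic0 f"
    and g: "germ g \<in> Idl\<^bsub>convergent_series\<^esub> (germ ` F)"
  shows "\<forall>\<^sub>F v in nhds 0. (\<forall>f\<in>F. f v = 0) \<longrightarrow> g v = 0"
proof -
  let ?R = "convergent_series :: ('k ^ 'n \<Rightarrow> 'k) set ring"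
  \<comment> \<open>The quantifier over \<open>F\<close> rebinds \<open>f\<close>; the last
    \<open>f\<close> in the formula is the argument of \<open>van\<close>.\<close>
  define van where "van f \<longleftrightarrow> (\<forall>\<^sub>F v in nhds 0. (\<forall>f\<in>F. f v = 0) \<longrightarrow> f v = 0)" for f :: "'k ^ 'n \<Rightarrow> 'k"
  define J where "J = germ ` {f. analytic0 f \<and> van f}"
  interpret cring ?R by (rule cring_convergent_series)
  have neg: "\<ominus>\<^bsub>?R\<^esub> germ f = germ (\<lambda>v. - f v)" if "analytic0 f" for f :: "'k ^ 'n \<Rightarrow> 'k"
    by (rule minus_equality)
      (auto simp: germ_add carrier_convergent_series zero_convergent_series analytic0_uminus that)
  have van_add: "van (\<lambda>v. f v + f' v)" if "van f" "van f'" for f f'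
    using that unfolding van_def by eventually_elim simp
  have van_mult: "van (\<lambda>v. f v * f' v)" if "van f" for f f'
    using that unfolding van_def by eventually_elim simp
  have "ideal J ?R"
  proof (rule idealI)
    show "subgroup J (add_monoid ?R)"
    proof (rule add.subgroupI)
      have "germ (\<lambda>_. 0) \<in> J" by (auto simp: J_def van_def analytic0_const)
      then show "J \<noteq> {}" by blast
      show "\<ominus>\<^bsub>?R\<^esub> a \<in> J" if "a \<in> J" for a
        using that van_mult[of _ "\<lambda>_. - 1"] by (auto simp: J_def neg analytic0_uminus)
      show "a \<oplus>\<^bsub>?R\<^esub> b \<in> J" if "a \<in> J" "b \<in> J" for a b
        using that by (auto simp: J_def germ_add van_add analytic0_add)
    qed (auto simp: J_def carrier_convergent_series)
    show *: "a \<otimes>\<^bsub>?R\<^esub> x \<in> J" if "a \<in> J" "x \<in> carrier ?R" for a x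
      using that by (auto simp: J_def carrier_convergent_series germ_mult van_mult analytic0_mult)
    show "x \<otimes>\<^bsub>?R\<^esub> a \<in> J" if "a \<in> J" "x \<in> carrier ?R" for a x
    proof -
      have "a \<in> carrier ?R" using that(1) by (auto simp: J_def carrier_convergent_series)
      then show ?thesis using *[OF that] m_comm that(2) by metis
    qed
  qed (rule ring_axioms)
  moreover have "germ ` F \<subseteq> J" using F by (auto simp: J_def van_def)
  ultimately have "Idl\<^bsub>?R\<^esub> (germ ` F) \<subseteq> J" by (rule genideal_minimal)
  then obtain f where "germ g = germ f" "van f" using g by (auto simp: J_def)
  then show ?thesis
    unfolding germ_eq_iff van_def by (rule eventually_elim2) simp
qed

text \<open>At a common zero each coordinate is a root of its polynomial in the ideal, and near the
  origin the only possible root is 0. This direction of the Nullstellensatz holds over the reals as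
  well.\<close>

lemma finite_dim_quotient_isolated_zero:
  fixes F :: "('k::{real_normed_field, banach} ^ 'n::finite \<Rightarrow> 'k) set"
  assumes F: "\<And>f. f \<in> F \<Longrightarrow> analytic0 f"
    and fin: "finite_dim_quotient (Idl\<^bsub>convergent_series\<^esub> (germ ` F))"
  shows "\<forall>\<^sub>F v in nhds 0. (\<forall>f\<in>F. f v = 0) \<longrightarrow> v = 0"
proof -
  interpret cring "convergent_series :: ('k ^ 'n \<Rightarrow> 'k) set ring" by (rule cring_convergent_series)
  have I: "ideal (Idl\<^bsub>convergent_series\<^esub> (germ ` F)) convergent_series"
    by (rule genideal_ideal) (use F in \<open>auto simp: carrier_convergent_series\<close>)
  have "\<forall>\<^sub>F v in nhds 0. (\<forall>f\<in>F. f v = 0) \<longrightarrow> v $ i = 0" for i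
  proof -
    obtain p where p: "p \<noteq> 0" "germ (\<lambda>v. poly p (v $ i)) \<in> Idl\<^bsub>convergent_series\<^esub> (germ ` F)"
      using finite_dim_quotient_polynomial[OF I fin analytic0_coordinate] by blast
    \<comment> \<open>The nonzero roots are finitely many, so the complement of \<open>?Z\<close> is
      an open neighbourhood of 0 in which 0 is the only possible root.\<close>
    let ?Z = "{a. poly p a = 0} - {0}"
    have "open (- ?Z)"
      by (intro open_Compl finite_imp_closed finite_Diff poly_roots_finite p)
    then have "\<forall>\<^sub>F a in nhds 0. a \<in> - ?Z" by (rule eventually_nhds_in_open) simp
    moreover have "((\<lambda>v :: 'k ^ 'n. v) \<longlongrightarrow> 0) (nhds 0)" by (rule filterlim_ident)
    then have "((\<lambda>v :: 'k ^ 'n. v $ i) \<longlongrightarrow> 0) (nhds 0)"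
      using tendsto_vec_nth[of _ 0 _ i] by simp
    ultimately have "\<forall>\<^sub>F v :: 'k ^ 'n in nhds 0. v $ i \<in> - ?Z"
      by (rule eventually_compose_filterlim)
    moreover have "\<forall>\<^sub>F v in nhds 0. (\<forall>f\<in>F. f v = 0) \<longrightarrow> poly p (v $ i) = 0"
      using F p(2) by (rule genideal_vanishes)
    ultimately show ?thesis
      by eventually_elim auto
  qed
  then have "\<forall>\<^sub>F v in nhds 0. \<forall>i. (\<forall>f\<in>F. f v = 0) \<longrightarrow> v $ i = 0"
    by (rule eventually_all_finite)
  then show ?thesis by eventually_elim (simp add: vec_eq_iff)
qed

section \<open>Triple points as common zeros\<close>

text \<open>Cramer's rule: the minor times \<open>s\<close>, and likewise times \<open>t\<close>, is
  a combination of the two vanishing left-hand sides, and a nonzero one of \<open>s\<close>,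
  \<open>t\<close> cancels.\<close>

lemma minor_eq_zero:
  fixes a b a' b' s t :: "'a::idom"
  assumes "a * s + b * t = 0" "a' * s + b' * t = 0" "s \<noteq> 0 \<or> t \<noteq> 0"
  shows "a * b' - b * a' = 0"
proof -
  have "(a * b' - b * a') * s = b' * (a * s + b * t) - b * (a' * s + b' * t)"
    "(a * b' - b * a') * t = a * (a' * s + b' * t) - a' * (a * s + b * t)"
    by (simp_all add: algebra_simps)
  then show ?thesis using assms by auto
qed

definition triple6 :: "'k::zero ^ 2 \<Rightarrow> 'k ^ 2 \<Rightarrow> 'k ^ 2 \<Rightarrow> 'k ^ 6" where
  "triple6 p q r = (\<chi> i. if i = 1 then p $ 1 else if i = 2 then p $ 2 else if i = 3 then q $ 1
     else if i = 4 then q $ 2 else if i = 5 then r $ 1 else r $ 2)"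

lemma of_triple6:
  "x_of (triple6 p q r) = p" "y_of (triple6 p q r) = q" "z_of (triple6 p q r) = r"
  by (simp_all add: triple6_def x_of_def y_of_def z_of_def vec_eq_iff forall_2)

text \<open>Pulls a condition valid near the origin of \<open>'k ^ 6\<close> back to triples of
  points near the origin of the plane.\<close>

lemma tendsto_triple6:
  "((\<lambda>(p, q, r). triple6 p q r) \<longlongrightarrow> (0 :: 'k::real_normed_field ^ 6)) (nhds (0, 0, 0))"
proof -
  note w = filterlim_ident[of "nhds (0 :: 'k ^ 2, 0 :: 'k ^ 2, 0 :: 'k ^ 2)"]
  have "((\<lambda>w :: ('k ^ 2) \<times> ('k ^ 2) \<times> ('k ^ 2). triple6 (fst w) (fst (snd w)) (snd (snd w)) $ i) \<longlongrightarrow> 0) (nhds (0, 0, 0))" for i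
    using w[THEN tendsto_fst, THEN tendsto_vec_nth] w[THEN tendsto_snd, THEN tendsto_fst, THEN tendsto_vec_nth]
      w[THEN tendsto_snd, THEN tendsto_snd, THEN tendsto_vec_nth]
    unfolding triple6_def
    by (cases "i = 1"; cases "i = 2"; cases "i = 3"; cases "i = 4"; cases "i = 5") simp_all
  then show ?thesis by (intro vec_tendstoI) (simp add: case_prod_unfold)
qed

theorem corollary5p7:
  fixes u :: "'k::{real_normed_field, banach} ^ 2 \<Rightarrow> 'k ^ 3"
    and c :: "3 \<Rightarrow> 2 \<Rightarrow> 'k ^ 4 \<Rightarrow> 'k"
  assumes u_zero: "u 0 = 0"
    and u_analytic: "\<And>i. analytic0 (\<lambda>x. u x $ i)"
    and u_critical: "isolated_critical_point u"
    and c_analytic: "\<And>i k. analytic0 (c i k)"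
    and c_decomp: "\<And>i. \<forall>\<^sub>F (x, y) in nhds (0, 0).
          diff_w u i x y
            = c i 1 (pair4 x y) * (x $ 1 - y $ 1) + c i 2 (pair4 x y) * (x $ 2 - y $ 2)"
    and fin: "finite_dim_quotient (S_ideal u c)"
  shows "\<exists>U. open U \<and> 0 \<in> U \<and> \<not> (\<exists>p\<in>U. \<exists>q\<in>U. \<exists>r\<in>U. triple_point u p q r)"
proof -
  \<comment> \<open>All three decompositions at one pair of points, so that a single neighbourhood
    serves every \<open>i\<close>.\<close>
  define D where "D x y \<longleftrightarrow> (\<forall>i. diff_w u i x y
      = c i 1 (pair4 x y) * (x $ 1 - y $ 1) + c i 2 (pair4 x y) * (x $ 2 - y $ 2))" for x y
  have D: "minor_W c i j x y = 0" if "D x y" "u x = u y" "x \<noteq> y" for i j x y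
    unfolding minor_W_def
  proof (rule minor_eq_zero)
    show "x $ 1 - y $ 1 \<noteq> 0 \<or> x $ 2 - y $ 2 \<noteq> 0" using that(3) by (auto simp: vec_eq_iff forall_2)
  qed (use that in \<open>auto simp: D_def diff_w_def\<close>)
  have "\<forall>\<^sub>F w in nhds (0, 0). D (fst w) (snd w)"
    using eventually_all_finite[OF c_decomp] by (simp add: D_def case_prod_unfold)
  \<comment> \<open>With one neighbourhood per argument, any two points of
    \<open>A \<inter> B\<close> satisfy \<open>D\<close> in either order, which covers the pairs
    \<open>(p, q)\<close>, \<open>(q, r)\<close> and \<open>(p, r)\<close>.\<close>
  then obtain A B where AB: "open A" "open B" "0 \<in> A" "0 \<in> B" "\<And>x y. x \<in> A \<Longrightarrow> y \<in> B \<Longrightarrow> D x y"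
    unfolding nhds_prod eventually_prod_filter eventually_nhds by (metis fst_conv snd_conv)
  have "\<forall>\<^sub>F v in nhds 0. (\<forall>f\<in>set (S_functions u c). f v = 0) \<longrightarrow> v = 0"
    using fin unfolding S_ideal_def
    by (intro finite_dim_quotient_isolated_zero S_functions_analytic0[OF u_analytic c_analytic])
  then have "\<forall>\<^sub>F (p, q, r) in nhds (0, 0, 0).
      (\<forall>f\<in>set (S_functions u c). f (triple6 p q r) = 0) \<longrightarrow> triple6 p q r = 0"
    using eventually_compose_filterlim[OF _ tendsto_triple6] by (simp add: case_prod_unfold)
  then obtain N where N: "open N" "(0, 0, 0) \<in> N"
    "\<forall>(p, q, r)\<in>N. (\<forall>f\<in>set (S_functions u c). f (triple6 p q r) = 0) \<longrightarrow> triple6 p q r = 0"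
    unfolding eventually_nhds by blast
  \<comment> \<open>The neighbourhood \<open>N\<close> of triples is shrunk to a box
    \<open>X \<times> Y \<times> Z\<close>; intersecting the factors gives one set from which all
    three points may be taken.\<close>
  obtain X YZ where X: "open X" "open YZ" "(0, 0, 0) \<in> X \<times> YZ" "X \<times> YZ \<subseteq> N"
    by (rule open_prod_elim[OF N(1,2)])
  then obtain Y Z where YZ: "open Y" "open Z" "(0, 0) \<in> Y \<times> Z" "Y \<times> Z \<subseteq> YZ"
    using open_prod_elim[OF X(2)] by blast
  let ?U = "A \<inter> B \<inter> X \<inter> Y \<inter> Z"
  have False if U: "p \<in> ?U" "q \<in> ?U" "r \<in> ?U" and t: "triple_point u p q r" for p q r
  proof -
    have t': "p \<noteq> q" "p \<noteq> r" "q \<noteq> r" "u p = u q" "u q = u r" "u p = u r"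
      using t by (auto simp: triple_point_def)
    have DD: "D p q" "D q r" "D p r" using U AB(5) by auto
    \<comment> \<open>The pair \<open>(p, r)\<close> enters through the last three minors; every
      other generator concerns \<open>(p, q)\<close> or \<open>(q, r)\<close>.\<close>
    have "\<forall>f\<in>set (S_functions u c). f (triple6 p q r) = 0"
      using t' DD by (simp add: S_functions_def of_triple6 D diff_w_def)
    moreover have "(p, q, r) \<in> N" using X(4) YZ(4) U by auto
    ultimately have "triple6 p q r = 0" using N(3) by blast
    \<comment> \<open>The \<open>x_of\<close> and \<open>y_of\<close> parts of the zero vector
      coincide.\<close>
    then have "p = q" using of_triple6[of p q r] by (simp add: x_of_def y_of_def)
    then show False using t'(1) by blast
  qed
  then show ?thesis using AB X YZ by (intro exI[of _ ?U]) auto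
qed

end
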